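(* Let $R$ be a commutative ring and $p,q\in R$ with $pq+2=0$. Let $\mathsf{K}(R)$ be the multiplicative monoid of matrices $\begin{pmatrix}1&r\\0&s\end{pmatrix}$ with $r,s\in R$, and let $\mathsf{A}(R)$ be the commutative monoid with underlying set $R^2$, elements written $[a,b]$, multiplication $$[a,b][c,d]=[ac,\ a^2d+bc^2+p^2bd]$$ and unit $[1,0]$. For $k=\begin{pmatrix}1&r\\0&s\end{pmatrix}\in\mathsf{K}(R)$ and $m=[a,b]\in\mathsf{A}(R)$ set $$m\circ k=[as-pr,\ s^2b-qrsa-r^2],\qquad k^{m}=\begin{pmatrix}1&ra\\0&s\end{pmatrix}={}^{m}k.$$ In this way one obtains a crossed semi-bimodule $(\mathsf{K}(R),\mathsf{A}(R),\circ)$.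
   Context: A crossed semi-bimodule $(K,A,\circ)$ consists of monoids $A$ and $K$ (written multiplicatively, units denoted $1$), together with maps $A\times K\to A,\ (a,x)\mapsto a\circ x$; $A\times K\to K,\ (a,x)\mapsto {}^{a}x$; $K\times A\to K,\ (x,a)\mapsto x^{a}$, such that: the first map makes $A$ into a right $K$-set ($a\circ 1=a$, $a\circ(xy)=(a\circ x)\circ y$); the second makes $K$ into a left $A$-monoid (a left action of $A$ on $K$ by monoid endomorphisms: ${}^{1}x=x$, ${}^{ab}x={}^{a}({}^{b}x)$, ${}^{a}(xy)={}^{a}x\,{}^{a}y$, ${}^{a}1=1$); the third makes $K$ into a right $A$-monoid ($x^{1}=x$, $x^{ab}=(x^{a})^{b}$, $(xy)^{a}=x^{a}y^{a}$, $1^{a}=1$); and for all $x,y\in K$, $a,b\in A$: (1) $({}^{a}x)^{b}={}^{a}(x^{b})$; (2) $(ab)\circ({}^{a}x)=a(b\circ x)$; (3) $(ab)\circ(x^{b})=(a\circ x)b$; (4) $({}^{a}y)\,x^{b\circ y}=x^{b}\,({}^{a\circ x}y)$. *)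

theory Defs
  imports "HOL-Algebra.Ring" "HOL-Analysis.Cartesian_Space"
begin

locale crossed_semi_bimodule = K: monoid K + A: monoid A
  for K :: "('k, 'u) monoid_scheme" and A :: "('a, 'v) monoid_scheme" +
  fixes circ :: "'a \<Rightarrow> 'k \<Rightarrow> 'a"
    and lact :: "'a \<Rightarrow> 'k \<Rightarrow> 'k"
    and ract :: "'k \<Rightarrow> 'a \<Rightarrow> 'k"
  assumes circ_closed: "\<lbrakk>a \<in> carrier A; x \<in> carrier K\<rbrakk> \<Longrightarrow> circ a x \<in> carrier A"
    and circ_one: "a \<in> carrier A \<Longrightarrow> circ a \<one>\<^bsub>K\<^esub> = a"
    and circ_mult: "\<lbrakk>a \<in> carrier A; x \<in> carrier K; y \<in> carrier K\<rbrakk>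
          \<Longrightarrow> circ a (x \<otimes>\<^bsub>K\<^esub> y) = circ (circ a x) y"
    and lact_closed: "\<lbrakk>a \<in> carrier A; x \<in> carrier K\<rbrakk> \<Longrightarrow> lact a x \<in> carrier K"
    and lact_by_one: "x \<in> carrier K \<Longrightarrow> lact \<one>\<^bsub>A\<^esub> x = x"
    and lact_by_mult: "\<lbrakk>a \<in> carrier A; b \<in> carrier A; x \<in> carrier K\<rbrakk>
          \<Longrightarrow> lact (a \<otimes>\<^bsub>A\<^esub> b) x = lact a (lact b x)"
    and lact_mult: "\<lbrakk>a \<in> carrier A; x \<in> carrier K; y \<in> carrier K\<rbrakk>
          \<Longrightarrow> lact a (x \<otimes>\<^bsub>K\<^esub> y) = lact a x \<otimes>\<^bsub>K\<^esub> lact a y"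
    and lact_one: "a \<in> carrier A \<Longrightarrow> lact a \<one>\<^bsub>K\<^esub> = \<one>\<^bsub>K\<^esub>"
    and ract_closed: "\<lbrakk>x \<in> carrier K; a \<in> carrier A\<rbrakk> \<Longrightarrow> ract x a \<in> carrier K"
    and ract_by_one: "x \<in> carrier K \<Longrightarrow> ract x \<one>\<^bsub>A\<^esub> = x"
    and ract_by_mult: "\<lbrakk>x \<in> carrier K; a \<in> carrier A; b \<in> carrier A\<rbrakk>
          \<Longrightarrow> ract x (a \<otimes>\<^bsub>A\<^esub> b) = ract (ract x a) b"
    and ract_mult: "\<lbrakk>x \<in> carrier K; y \<in> carrier K; a \<in> carrier A\<rbrakk>
          \<Longrightarrow> ract (x \<otimes>\<^bsub>K\<^esub> y) a = ract x a \<otimes>\<^bsub>K\<^esub> ract y a"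
    and ract_one: "a \<in> carrier A \<Longrightarrow> ract \<one>\<^bsub>K\<^esub> a = \<one>\<^bsub>K\<^esub>"
    and lact_ract: "\<lbrakk>a \<in> carrier A; b \<in> carrier A; x \<in> carrier K\<rbrakk>
          \<Longrightarrow> ract (lact a x) b = lact a (ract x b)"
    and mult_circ_lact: "\<lbrakk>a \<in> carrier A; b \<in> carrier A; x \<in> carrier K\<rbrakk>
          \<Longrightarrow> circ (a \<otimes>\<^bsub>A\<^esub> b) (lact a x) = a \<otimes>\<^bsub>A\<^esub> circ b x"
    and mult_circ_ract: "\<lbrakk>a \<in> carrier A; b \<in> carrier A; x \<in> carrier K\<rbrakk>
          \<Longrightarrow> circ (a \<otimes>\<^bsub>A\<^esub> b) (ract x b) = circ a x \<otimes>\<^bsub>A\<^esub> b"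
    and lact_ract_mult: "\<lbrakk>a \<in> carrier A; b \<in> carrier A; x \<in> carrier K; y \<in> carrier K\<rbrakk>
          \<Longrightarrow> lact a y \<otimes>\<^bsub>K\<^esub> ract x (circ b y) = ract x b \<otimes>\<^bsub>K\<^esub> lact (circ a x) y"

(* The library product ** needs the entries to form a type of class semiring_1, which excludes the
   zero ring; these are the same matrices over a ring given by its carrier. *)
definition matrix_monoid :: "('r, 'm) ring_scheme \<Rightarrow> ('r ^ 'n ^ 'n) monoid" where
  "matrix_monoid R =
    \<lparr>carrier = {M. \<forall>i j. M $ i $ j \<in> carrier R},
     mult = (\<lambda>M N. \<chi> i j. \<Oplus>\<^bsub>R\<^esub>k\<in>UNIV. M $ i $ k \<otimes>\<^bsub>R\<^esub> N $ k $ j),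
     one = (\<chi> i j. if i = j then \<one>\<^bsub>R\<^esub> else \<zero>\<^bsub>R\<^esub>)\<rparr>"

(* rows (1, r) and (0, s) *)
definition K_mat :: "('r, 'm) ring_scheme \<Rightarrow> 'r \<Rightarrow> 'r \<Rightarrow> 'r ^ 2 ^ 2" where
  "K_mat R r s = (\<chi> i j. if i = 1 then (if j = 1 then \<one>\<^bsub>R\<^esub> else r)
                         else (if j = 1 then \<zero>\<^bsub>R\<^esub> else s))"

definition K_monoid :: "('r, 'm) ring_scheme \<Rightarrow> ('r ^ 2 ^ 2) monoid" where
  "K_monoid R = (matrix_monoid R)\<lparr>carrier := {K_mat R r s | r s. r \<in> carrier R \<and> s \<in> carrier R}\<rparr>"

definition A_monoid :: "('r, 'm) ring_scheme \<Rightarrow> 'r \<Rightarrow> ('r \<times> 'r) monoid" where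
  "A_monoid R p =
    \<lparr>carrier = carrier R \<times> carrier R,
     mult = (\<lambda>(a, b) (c, d).
       (a \<otimes>\<^bsub>R\<^esub> c,
        (a [^]\<^bsub>R\<^esub> (2::nat)) \<otimes>\<^bsub>R\<^esub> d \<oplus>\<^bsub>R\<^esub> b \<otimes>\<^bsub>R\<^esub> (c [^]\<^bsub>R\<^esub> (2::nat))
          \<oplus>\<^bsub>R\<^esub> (p [^]\<^bsub>R\<^esub> (2::nat)) \<otimes>\<^bsub>R\<^esub> b \<otimes>\<^bsub>R\<^esub> d)),
     one = (\<one>\<^bsub>R\<^esub>, \<zero>\<^bsub>R\<^esub>)\<rparr>"

definition A_circ :: "('r, 'm) ring_scheme \<Rightarrow> 'r \<Rightarrow> 'r \<Rightarrow> 'r \<times> 'r \<Rightarrow> 'r ^ 2 ^ 2 \<Rightarrow> 'r \<times> 'r" where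
  "A_circ R p q m k =
    (let a = fst m; b = snd m; r = k $ 1 $ 2; s = k $ 2 $ 2 in
      (a \<otimes>\<^bsub>R\<^esub> s \<ominus>\<^bsub>R\<^esub> p \<otimes>\<^bsub>R\<^esub> r,
       (s [^]\<^bsub>R\<^esub> (2::nat)) \<otimes>\<^bsub>R\<^esub> b \<ominus>\<^bsub>R\<^esub> q \<otimes>\<^bsub>R\<^esub> r \<otimes>\<^bsub>R\<^esub> s \<otimes>\<^bsub>R\<^esub> a
         \<ominus>\<^bsub>R\<^esub> (r [^]\<^bsub>R\<^esub> (2::nat))))"

definition K_act :: "('r, 'm) ring_scheme \<Rightarrow> 'r ^ 2 ^ 2 \<Rightarrow> 'r \<times> 'r \<Rightarrow> 'r ^ 2 ^ 2" where
  "K_act R k m = K_mat R (k $ 1 $ 2 \<otimes>\<^bsub>R\<^esub> fst m) (k $ 2 $ 2)"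

end

theory Submission
  imports Defs
begin

text \<open>Writing an element of the matrix monoid as \<open>(r, s)\<close>, the relation \<open>pq = -2\<close> enters only in
  two places: the cross term \<open>-2rr's'\<close> of \<open>(r' + rs')\<^sup>2\<close> in \<open>a \<circ> (xy)\<close> matches
  \<open>pqrr's'\<close> in \<open>(a \<circ> x) \<circ> y\<close>, and in axiom (2) the cross term of \<open>(cs - pr)\<^sup>2\<close> cancels
  against \<open>-p\<^sup>2qrsc\<close>. Axiom (3) is axiom (2) read through commutativity of the second monoid, as the
  left and right actions coincide.\<close>

lemma K_mat_entry [simp]:
  "K_mat R r s $ 1 $ 1 = \<one>\<^bsub>R\<^esub>" "K_mat R r s $ 1 $ 2 = r"
  "K_mat R r s $ 2 $ 1 = \<zero>\<^bsub>R\<^esub>" "K_mat R r s $ 2 $ 2 = s"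
  by (simp_all add: K_mat_def)

lemma K_mat_eq_iff [simp]: "K_mat R r s = K_mat R r' s' \<longleftrightarrow> r = r' \<and> s = s'"
  by (metis K_mat_entry(2,4))

lemma K_act_K_mat: "K_act R (K_mat R r s) (a, b) = K_mat R (r \<otimes>\<^bsub>R\<^esub> a) s"
  by (simp add: K_act_def)

lemma carrier_K_monoid: "carrier (K_monoid R) = {K_mat R r s | r s. r \<in> carrier R \<and> s \<in> carrier R}"
  by (simp add: K_monoid_def)

lemma one_K_monoid: "\<one>\<^bsub>K_monoid R\<^esub> = K_mat R \<zero>\<^bsub>R\<^esub> \<one>\<^bsub>R\<^esub>"
  by (simp add: K_monoid_def matrix_monoid_def K_mat_def vec_eq_iff forall_2)

lemma carrier_A_monoid: "carrier (A_monoid R p) = carrier R \<times> carrier R"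
  by (simp add: A_monoid_def)

lemma one_A_monoid: "\<one>\<^bsub>A_monoid R p\<^esub> = (\<one>\<^bsub>R\<^esub>, \<zero>\<^bsub>R\<^esub>)"
  by (simp add: A_monoid_def)

context cring
begin

lemma nat_pow_two: "x \<in> carrier R \<Longrightarrow> x [^] (2::nat) = x \<otimes> x"
  by (simp add: numeral_2_eq_2)

text \<open>The sum over the two matrix indices is expanded here once; afterwards closure,
  associativity and all axioms are computations in the coordinates \<open>(r, s)\<close>.\<close>

lemma mult_K_mat:
  assumes "r \<in> carrier R" "s \<in> carrier R" "r' \<in> carrier R" "s' \<in> carrier R"
  shows "K_mat R r s \<otimes>\<^bsub>K_monoid R\<^esub> K_mat R r' s' = K_mat R (r' \<oplus> r \<otimes> s') (s \<otimes> s')"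
  using assms
  by (simp add: K_monoid_def matrix_monoid_def vec_eq_iff forall_2 UNIV_2 finsum_insert Pi_def)

lemma monoid_K_monoid: "monoid (K_monoid R)"
proof
qed (auto simp: carrier_K_monoid one_K_monoid mult_K_mat l_distr a_assoc m_assoc)

lemma mult_A_monoid:
  assumes "a \<in> carrier R" "b \<in> carrier R" "c \<in> carrier R" "d \<in> carrier R" "p \<in> carrier R"
  shows "(a, b) \<otimes>\<^bsub>A_monoid R p\<^esub> (c, d) =
    (a \<otimes> c, a \<otimes> a \<otimes> d \<oplus> b \<otimes> (c \<otimes> c) \<oplus> p \<otimes> p \<otimes> b \<otimes> d)"
  using assms by (simp add: A_monoid_def nat_pow_two)

text \<open>Second component of associativity. With N(a, b) = a^2 + p^2 b, the second component of a
  product is a^2 d + b N(c, d), and N is multiplicative.\<close>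

lemma A_monoid_assoc_identity:
  assumes "a \<in> carrier R" "b \<in> carrier R" "c \<in> carrier R" "d \<in> carrier R"
    "e \<in> carrier R" "f \<in> carrier R" "p \<in> carrier R"
  shows "a \<otimes> c \<otimes> (a \<otimes> c) \<otimes> f \<oplus> (a \<otimes> a \<otimes> d \<oplus> b \<otimes> (c \<otimes> c) \<oplus> p \<otimes> p \<otimes> b \<otimes> d) \<otimes> (e \<otimes> e)
      \<oplus> p \<otimes> p \<otimes> (a \<otimes> a \<otimes> d \<oplus> b \<otimes> (c \<otimes> c) \<oplus> p \<otimes> p \<otimes> b \<otimes> d) \<otimes> f =
    a \<otimes> a \<otimes> (c \<otimes> c \<otimes> f \<oplus> d \<otimes> (e \<otimes> e) \<oplus> p \<otimes> p \<otimes> d \<otimes> f) \<oplus> b \<otimes> (c \<otimes> e \<otimes> (c \<otimes> e))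
      \<oplus> p \<otimes> p \<otimes> b \<otimes> (c \<otimes> c \<otimes> f \<oplus> d \<otimes> (e \<otimes> e) \<oplus> p \<otimes> p \<otimes> d \<otimes> f)"
  using assms by (simp add: l_distr r_distr m_ac a_ac)

lemma comm_monoid_A_monoid:
  assumes p: "p \<in> carrier R"
  shows "comm_monoid (A_monoid R p)"
proof (rule comm_monoidI)
  fix x y z
  assume "x \<in> carrier (A_monoid R p)" "y \<in> carrier (A_monoid R p)" "z \<in> carrier (A_monoid R p)"
  then show "x \<otimes>\<^bsub>A_monoid R p\<^esub> y \<otimes>\<^bsub>A_monoid R p\<^esub> z = x \<otimes>\<^bsub>A_monoid R p\<^esub> (y \<otimes>\<^bsub>A_monoid R p\<^esub> z)"
    using p by (auto simp: carrier_A_monoid mult_A_monoid A_monoid_assoc_identity intro: m_assoc)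
next
  fix x y
  assume "x \<in> carrier (A_monoid R p)" "y \<in> carrier (A_monoid R p)"
  then show "x \<otimes>\<^bsub>A_monoid R p\<^esub> y = y \<otimes>\<^bsub>A_monoid R p\<^esub> x"
    using p by (auto simp: carrier_A_monoid mult_A_monoid m_ac a_ac)
qed (use p in \<open>auto simp: carrier_A_monoid one_A_monoid mult_A_monoid\<close>)

text \<open>Normalises ring expressions to ordered sums of signed monomials with right-nested
  products.\<close>

lemmas distribs = minus_eq l_distr r_distr l_minus r_minus minus_add m_ac a_ac

text \<open>The cross terms and x^2 cancel. It is applied with x = pr, y = cs and z = p^2 s^2
  d.\<close>

lemma square_diff_add:
  assumes "x \<in> carrier R" "y \<in> carrier R" "z \<in> carrier R"
  shows "(y \<ominus> x) \<otimes> (y \<ominus> x) \<oplus> (z \<oplus> (x \<otimes> y \<oplus> x \<otimes> y) \<ominus> x \<otimes> x) = y \<otimes> y \<oplus> z"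
  using assms by algebra

text \<open>The relation pq = -2 with a cofactor \<open>x\<close>, since right-nested monomials
  contain \<open>p\<close> and \<open>q\<close> in this shape. Writing \<open>x\<close> twice keeps
  the result a sum of monomials.\<close>

lemma mult_mult_eq_minus:
  assumes "p \<in> carrier R" "q \<in> carrier R" "p \<otimes> q \<oplus> (\<one> \<oplus> \<one>) = \<zero>" "x \<in> carrier R"
  shows "p \<otimes> (q \<otimes> x) = \<ominus> (x \<oplus> x)"
proof -
  have "p \<otimes> q = \<ominus> (\<one> \<oplus> \<one>)"
    using assms by (simp add: sum_zero_eq_neg)
  then have "p \<otimes> (q \<otimes> x) = \<ominus> (\<one> \<oplus> \<one>) \<otimes> x"
    using assms by (metis m_assoc)
  also have "\<dots> = \<ominus> (x \<oplus> x)"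
    using assms by algebra
  finally show ?thesis .
qed

lemma A_circ_K_mat:
  assumes "a \<in> carrier R" "b \<in> carrier R" "r \<in> carrier R" "s \<in> carrier R"
  shows "A_circ R p q (a, b) (K_mat R r s) =
    (a \<otimes> s \<ominus> p \<otimes> r, s \<otimes> s \<otimes> b \<ominus> q \<otimes> r \<otimes> s \<otimes> a \<ominus> r \<otimes> r)"
  using assms by (simp add: A_circ_def nat_pow_two)

lemma K_act_mult_A:
  assumes "p \<in> carrier R" "x \<in> carrier (K_monoid R)"
    "m \<in> carrier (A_monoid R p)" "n \<in> carrier (A_monoid R p)"
  shows "K_act R x (m \<otimes>\<^bsub>A_monoid R p\<^esub> n) = K_act R (K_act R x m) n"
  using assms
  by (auto simp: carrier_K_monoid carrier_A_monoid mult_A_monoid K_act_K_mat m_assoc)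

text \<open>Acting scales the upper right entry, and R is commutative. This gives axiom (1) and also
  turns the right action law into the left one.\<close>

lemma K_act_commute:
  assumes "x \<in> carrier (K_monoid R)" "m \<in> carrier (A_monoid R p)" "n \<in> carrier (A_monoid R p)"
  shows "K_act R (K_act R x m) n = K_act R (K_act R x n) m"
  using assms by (auto simp: carrier_K_monoid carrier_A_monoid K_act_K_mat m_ac)

text \<open>For fixed s and s', the entry r' + r s' of a product is linear in (r, r'), so scaling
  both scales it.\<close>

lemma K_act_mult_K:
  assumes "x \<in> carrier (K_monoid R)" "y \<in> carrier (K_monoid R)" "m \<in> carrier (A_monoid R p)"
  shows "K_act R (x \<otimes>\<^bsub>K_monoid R\<^esub> y) m = K_act R x m \<otimes>\<^bsub>K_monoid R\<^esub> K_act R y m"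
  using assms
  by (auto simp: carrier_K_monoid carrier_A_monoid mult_K_mat K_act_K_mat l_distr r_distr m_ac)

lemma A_circ_mult:
  assumes p: "p \<in> carrier R" and q: "q \<in> carrier R" and pq: "p \<otimes> q \<oplus> (\<one> \<oplus> \<one>) = \<zero>"
    and "m \<in> carrier (A_monoid R p)" "x \<in> carrier (K_monoid R)" "y \<in> carrier (K_monoid R)"
  shows "A_circ R p q m (x \<otimes>\<^bsub>K_monoid R\<^esub> y) = A_circ R p q (A_circ R p q m x) y"
proof -
  obtain a b r s r' s' where eqs: "m = (a, b)" "x = K_mat R r s" "y = K_mat R r' s'"
    and a: "a \<in> carrier R" and b: "b \<in> carrier R" and r: "r \<in> carrier R"
    and s: "s \<in> carrier R" and r': "r' \<in> carrier R" and s': "s' \<in> carrier R"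
    using assms(4-6) by (auto simp: carrier_K_monoid carrier_A_monoid)
  note carr = a b r s r' s' p q
  have "a \<otimes> (s \<otimes> s') \<ominus> p \<otimes> (r' \<oplus> r \<otimes> s') = (a \<otimes> s \<ominus> p \<otimes> r) \<otimes> s' \<ominus> p \<otimes> r'"
    using carr by (simp add: distribs)
  \<comment> \<open>Only the last occurrence of \<open>p\<close> meets a factor \<open>q\<close>;
    rewriting that monomial supplies the cross term of the square.\<close>
  moreover have "s \<otimes> s' \<otimes> (s \<otimes> s') \<otimes> b \<ominus> q \<otimes> (r' \<oplus> r \<otimes> s') \<otimes> (s \<otimes> s') \<otimes> a
      \<ominus> (r' \<oplus> r \<otimes> s') \<otimes> (r' \<oplus> r \<otimes> s')
    = s' \<otimes> s' \<otimes> (s \<otimes> s \<otimes> b \<ominus> q \<otimes> r \<otimes> s \<otimes> a \<ominus> r \<otimes> r)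
      \<ominus> q \<otimes> r' \<otimes> s' \<otimes> (a \<otimes> s \<ominus> p \<otimes> r) \<ominus> r' \<otimes> r'"
    using carr by (simp add: distribs mult_mult_eq_minus[OF p q pq])
  ultimately show ?thesis
    using carr by (simp add: eqs mult_K_mat A_circ_K_mat)
qed

text \<open>The key is N(n \<circ> x) = s^2 N(n) for N(c, d) = c^2 + p^2 d: the second component of
  the product on the right depends on \<open>b\<close> only through b N(n \<circ> x).\<close>

lemma A_circ_mult_K_act:
  assumes p: "p \<in> carrier R" and q: "q \<in> carrier R" and pq: "p \<otimes> q \<oplus> (\<one> \<oplus> \<one>) = \<zero>"
    and "m \<in> carrier (A_monoid R p)" "n \<in> carrier (A_monoid R p)" "x \<in> carrier (K_monoid R)"
  shows "A_circ R p q (m \<otimes>\<^bsub>A_monoid R p\<^esub> n) (K_act R x m) = m \<otimes>\<^bsub>A_monoid R p\<^esub> A_circ R p q n x"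
proof -
  obtain a b c d r s where eqs: "m = (a, b)" "n = (c, d)" "x = K_mat R r s"
    and a: "a \<in> carrier R" and b: "b \<in> carrier R" and c: "c \<in> carrier R"
    and d: "d \<in> carrier R" and r: "r \<in> carrier R" and s: "s \<in> carrier R"
    using assms(4-6) by (auto simp: carrier_K_monoid carrier_A_monoid)
  note carr = a b c d r s p q
  let ?u = "c \<otimes> s \<ominus> p \<otimes> r" and ?w = "s \<otimes> s \<otimes> d \<ominus> q \<otimes> r \<otimes> s \<otimes> c \<ominus> r \<otimes> r"
  have "a \<otimes> c \<otimes> s \<ominus> p \<otimes> (r \<otimes> a) = a \<otimes> (c \<otimes> s \<ominus> p \<otimes> r)"
    using carr by (simp add: distribs)
  moreover have "s \<otimes> s \<otimes> (a \<otimes> a \<otimes> d \<oplus> b \<otimes> (c \<otimes> c) \<oplus> p \<otimes> p \<otimes> b \<otimes> d)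
      \<ominus> q \<otimes> (r \<otimes> a) \<otimes> s \<otimes> (a \<otimes> c) \<ominus> r \<otimes> a \<otimes> (r \<otimes> a)
    = a \<otimes> a \<otimes> ?w \<oplus> b \<otimes> (?u \<otimes> ?u) \<oplus> p \<otimes> p \<otimes> b \<otimes> ?w"
  proof -
    \<comment> \<open>The factor p^2 turns -qrsc into 2prsc, using pq = -2 once.\<close>
    have w: "p \<otimes> p \<otimes> ?w =
        p \<otimes> p \<otimes> (s \<otimes> s \<otimes> d) \<oplus> (p \<otimes> r \<otimes> (c \<otimes> s) \<oplus> p \<otimes> r \<otimes> (c \<otimes> s)) \<ominus> p \<otimes> r \<otimes> (p \<otimes> r)"
      using carr by (simp add: distribs mult_mult_eq_minus[OF p q pq])
    \<comment> \<open>This is the scaling N(u, w) = s^2 N(c, d).\<close>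
    have u: "?u \<otimes> ?u \<oplus> p \<otimes> p \<otimes> ?w = c \<otimes> s \<otimes> (c \<otimes> s) \<oplus> p \<otimes> p \<otimes> (s \<otimes> s \<otimes> d)"
      unfolding w by (rule square_diff_add) (use carr in simp_all)
    \<comment> \<open>Stated for variables \<open>u\<close> and \<open>w\<close>, so that collecting
      the factor \<open>b\<close> does not expand the two polynomials and N(u, w) stays
      visible.\<close>
    have "a \<otimes> a \<otimes> w \<oplus> b \<otimes> (u \<otimes> u) \<oplus> p \<otimes> p \<otimes> b \<otimes> w = a \<otimes> a \<otimes> w \<oplus> b \<otimes> (u \<otimes> u \<oplus> p \<otimes> p \<otimes> w)"
      if "u \<in> carrier R" "w \<in> carrier R" for u w
      using that carr by (simp add: distribs)
    then have "a \<otimes> a \<otimes> ?w \<oplus> b \<otimes> (?u \<otimes> ?u) \<oplus> p \<otimes> p \<otimes> b \<otimes> ?w =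
        a \<otimes> a \<otimes> ?w \<oplus> b \<otimes> (c \<otimes> s \<otimes> (c \<otimes> s) \<oplus> p \<otimes> p \<otimes> (s \<otimes> s \<otimes> d))"
      using carr by (simp only: u[symmetric]) simp
    then show ?thesis
      using carr by (simp add: distribs)
  qed
  ultimately show ?thesis
    using carr by (simp add: eqs mult_A_monoid A_circ_K_mat K_act_K_mat)
qed

text \<open>\<open>K_act\<close> sees only the first component of a pair, so the upper right entry
  on both sides is rcs' + r'as - prr', which is symmetric under exchanging (m, x) with (n,
  y).\<close>

lemma K_act_mult_exchange:
  assumes p: "p \<in> carrier R" and q: "q \<in> carrier R"
    and "m \<in> carrier (A_monoid R p)" "n \<in> carrier (A_monoid R p)"
    and "x \<in> carrier (K_monoid R)" "y \<in> carrier (K_monoid R)"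
  shows "K_act R y m \<otimes>\<^bsub>K_monoid R\<^esub> K_act R x (A_circ R p q n y) =
    K_act R x n \<otimes>\<^bsub>K_monoid R\<^esub> K_act R y (A_circ R p q m x)"
proof -
  obtain a b c d r s r' s'
    where eqs: "m = (a, b)" "n = (c, d)" "x = K_mat R r s" "y = K_mat R r' s'"
    and a: "a \<in> carrier R" and b: "b \<in> carrier R" and c: "c \<in> carrier R" and d: "d \<in> carrier R"
    and r: "r \<in> carrier R" and s: "s \<in> carrier R" and r': "r' \<in> carrier R" and s': "s' \<in> carrier R"
    using assms(3-6) by (auto simp: carrier_K_monoid carrier_A_monoid)
  note carr = a b c d r s r' s' p q
  have "r \<otimes> (c \<otimes> s' \<ominus> p \<otimes> r') \<oplus> r' \<otimes> a \<otimes> s = r' \<otimes> (a \<otimes> s \<ominus> p \<otimes> r) \<oplus> r \<otimes> c \<otimes> s'"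
    using carr by (simp add: distribs)
  then show ?thesis
    using carr by (simp add: eqs mult_K_mat A_circ_K_mat K_act_K_mat m_comm)
qed

end

theorem proposition6p2:
  fixes R :: "('r, 'm) ring_scheme" and p q :: 'r
  assumes "cring R"
    and "p \<in> carrier R" and "q \<in> carrier R"
    and "p \<otimes>\<^bsub>R\<^esub> q \<oplus>\<^bsub>R\<^esub> (\<one>\<^bsub>R\<^esub> \<oplus>\<^bsub>R\<^esub> \<one>\<^bsub>R\<^esub>) = \<zero>\<^bsub>R\<^esub>"
  shows "comm_monoid (A_monoid R p) \<and>
    crossed_semi_bimodule (K_monoid R) (A_monoid R p) (A_circ R p q) (\<lambda>m k. K_act R k m) (K_act R)"
proof
  interpret cring R by fact
  note p = assms(2) and q = assms(3) and pq = assms(4)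
  show A: "comm_monoid (A_monoid R p)"
    using p by (rule comm_monoid_A_monoid)
  interpret K: monoid "K_monoid R" by (rule monoid_K_monoid)
  interpret A: comm_monoid "A_monoid R p" by (rule A)
  note simps = carrier_K_monoid carrier_A_monoid one_K_monoid one_A_monoid A_circ_K_mat K_act_K_mat
  show "crossed_semi_bimodule (K_monoid R) (A_monoid R p) (A_circ R p q) (\<lambda>m k. K_act R k m) (K_act R)"
  proof (intro crossed_semi_bimodule.intro crossed_semi_bimodule_axioms.intro)
    fix m n x
    assume mem: "m \<in> carrier (A_monoid R p)" "n \<in> carrier (A_monoid R p)" "x \<in> carrier (K_monoid R)"
    show "A_circ R p q (m \<otimes>\<^bsub>A_monoid R p\<^esub> n) (K_act R x m) = m \<otimes>\<^bsub>A_monoid R p\<^esub> A_circ R p q n x"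
      using p q pq mem by (rule A_circ_mult_K_act)
    \<comment> \<open>Closure allows \<open>A.m_comm\<close> on the right-hand product below; axiom
      (3) is then axiom (2) with \<open>m\<close> and \<open>n\<close> exchanged.\<close>
    have "A_circ R p q m x \<in> carrier (A_monoid R p)"
      using mem p q by (auto simp: simps)
    then show "A_circ R p q (m \<otimes>\<^bsub>A_monoid R p\<^esub> n) (K_act R x n) = A_circ R p q m x \<otimes>\<^bsub>A_monoid R p\<^esub> n"
      using A_circ_mult_K_act[OF p q pq mem(2,1,3)] mem by (simp add: A.m_comm)
    \<comment> \<open>The left action law: the right law applies \<open>m\<close> first, and
      commuting the two actions reverses the order.\<close>
    show "K_act R x (m \<otimes>\<^bsub>A_monoid R p\<^esub> n) = K_act R (K_act R x n) m"
      using p mem by (simp add: K_act_mult_A K_act_commute[of x m p n])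
    show "K_act R (K_act R x m) n = K_act R (K_act R x n) m"
      using mem(3,1,2) by (rule K_act_commute)
  qed (use p q in \<open>auto simp: K_act_mult_A K_act_mult_K A_circ_mult[OF p q pq]
      K_act_mult_exchange K.monoid_axioms A.monoid_axioms simps minus_eq\<close>)
qed

end
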